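(* Let $k$ be a field and let $V$ be a $k$-vector space of finite dimension $n\geq 1$. Let $f\neq 0$ be in $V\otimes V$ and let $R$ be the one-dimensional subspace of $V\otimes V$ generated by $f$. Then the $2$-homogeneous graded algebra $A(V,R)=T(V)/I(R)$ is distributive.
   Context: $T(V)$ is the tensor algebra of $V$ ($V$ in degree $1$) and $I(R)$ the two-sided ideal generated by $R$. For a vector space $M$, $\mathcal{L}(M)$ denotes the lattice of its vector subspaces (infimum is intersection, supremum is sum). A triple $(E,F,G)$ of subspaces is distributive if $E\cap(F+G)=(E\cap F)+(E\cap G)$. A sublattice of $\mathcal{L}(M)$ is distributive if every triple of its elements is distributive. For $R\subseteq V^{\otimes N}$, the $N$-homogeneous algebra $A(V,R)$ is called distributive if for every $m\ge 0$ the sublattice of $\mathcal{L}(V^{\otimes m})$ generated by the subspaces $V^{\otimes i}\otimes R\otimes V^{\otimes j}$ with $i+N+j=m$ is distributive. Here $N=2$. *)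

theory Defs
  imports Complex_Main "HOL-Library.Function_Algebras" "HOL-Library.Set_Algebras"
begin

section \<open>Tensor powers of a vector space\<close>

text \<open>
  \<open>V\<close> is the vector space on the type \<open>'v\<close> with scalar multiplication \<open>scale\<close> over the field \<open>'k\<close>.
  A function \<open>\<phi> :: 'v list \<Rightarrow> 'k\<close> encodes a family of functions, one on \<open>V\<^sup>m\<close> for each \<open>m\<close>
  (its values on the lists of length \<open>m\<close>). It is a family of multilinear forms if it is
  linear in every entry of its argument.
\<close>

definition multilinear_forms ::
    "('k::field \<Rightarrow> 'v::ab_group_add \<Rightarrow> 'v) \<Rightarrow> ('v list \<Rightarrow> 'k) set" where
  "multilinear_forms scale =
     {\<phi>. \<forall>xs ys. Vector_Spaces.linear scale (*) (\<lambda>v. \<phi> (xs @ v # ys))}"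

text \<open>
  Tensors are functionals on multilinear forms, extended by \<open>0\<close> to all functions on lists:
  the decomposable tensor of \<open>v\<^sub>1, \<dots>, v\<^sub>m\<close> is evaluation at \<open>[v\<^sub>1, \<dots>, v\<^sub>m]\<close>. Restricting
  evaluation to multilinear forms imposes exactly the defining relations of the tensor product;
  see the universal property \<open>tensor_power_universal\<close>, \<open>tensor_power_unique\<close> below.
  The linear structure is pointwise; the pointwise multiplication of functions is not
  the product of tensors, which is \<open>tensor_mult\<close>.
\<close>

type_synonym ('k, 'v) tensor = "('v list \<Rightarrow> 'k) \<Rightarrow> 'k"

definition tensor_scale :: "'k::field \<Rightarrow> ('k, 'v) tensor \<Rightarrow> ('k, 'v) tensor" where
  "tensor_scale c t = (\<lambda>\<phi>. c * t \<phi>)"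

interpretation tensor: vector_space tensor_scale
  by unfold_locales (auto simp: tensor_scale_def fun_eq_iff algebra_simps)

definition pure_tensor ::
    "('k::field \<Rightarrow> 'v::ab_group_add \<Rightarrow> 'v) \<Rightarrow> 'v list \<Rightarrow> ('k, 'v) tensor" where
  "pure_tensor scale vs = (\<lambda>\<phi>. if \<phi> \<in> multilinear_forms scale then \<phi> vs else 0)"

definition tensor_power ::
    "('k::field \<Rightarrow> 'v::ab_group_add \<Rightarrow> 'v) \<Rightarrow> nat \<Rightarrow> ('k, 'v) tensor set" where
  "tensor_power scale m = tensor.span (pure_tensor scale ` {vs. length vs = m})"

text \<open>
  The product of the tensor algebra, i.e. the identification of the tensor product of the
  \<open>i\<close>-th and the \<open>j\<close>-th tensor power with the \<open>(i + j)\<close>-th one.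
\<close>

definition tensor_mult ::
    "('k::field \<Rightarrow> 'v::ab_group_add \<Rightarrow> 'v) \<Rightarrow> ('k, 'v) tensor \<Rightarrow> ('k, 'v) tensor \<Rightarrow> ('k, 'v) tensor"
  where
  "tensor_mult scale s t =
     (\<lambda>\<phi>. if \<phi> \<in> multilinear_forms scale then s (\<lambda>xs. t (\<lambda>ys. \<phi> (xs @ ys))) else 0)"

definition subspace_tensor ::
    "('k::field \<Rightarrow> 'v::ab_group_add \<Rightarrow> 'v) \<Rightarrow>
     ('k, 'v) tensor set \<Rightarrow> ('k, 'v) tensor set \<Rightarrow> ('k, 'v) tensor set" where
  "subspace_tensor scale E F = tensor.span {tensor_mult scale s t | s t. s \<in> E \<and> t \<in> F}"


section \<open>Properties of the construction\<close>

lemma vector_space_field: "vector_space ((*) :: 'k::field \<Rightarrow> 'k \<Rightarrow> 'k)"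
  by unfold_locales (auto simp: algebra_simps)

lemma linear_checkI:
  assumes "vector_space s1" "vector_space s2"
    and "\<And>x y. f (x + y) = f x + f y" and "\<And>c x. f (s1 c x) = s2 c (f x)"
  shows "Vector_Spaces.linear s1 s2 f"
  using assms by (simp add: Vector_Spaces.linear_iff)

lemma linear_eval: "Vector_Spaces.linear tensor_scale (*) (\<lambda>t :: ('k::field, 'v) tensor. t \<phi>)"
  by (rule linear_checkI[OF tensor.vector_space_axioms vector_space_field])
     (simp_all add: tensor_scale_def)

lemma pure_tensor_multilinear:
  fixes scale :: "'a::field \<Rightarrow> 'b::ab_group_add \<Rightarrow> 'b"
  assumes "vector_space scale"
  shows "Vector_Spaces.linear scale tensor_scale (\<lambda>v. pure_tensor scale (xs @ v # ys))"
proof -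
  interpret VK: vector_space_pair scale "(*)"
    by (intro vector_space_pair.intro vector_space_field assms)
  have lin: "Vector_Spaces.linear scale (*) (\<lambda>v. \<phi> (xs @ v # ys))"
    if "\<phi> \<in> multilinear_forms scale" for \<phi> :: "'b list \<Rightarrow> 'a"
    using that by (simp add: multilinear_forms_def)
  show ?thesis
  proof (rule linear_checkI[OF assms tensor.vector_space_axioms])
    fix v w c
    show "pure_tensor scale (xs @ (v + w) # ys)
      = pure_tensor scale (xs @ v # ys) + pure_tensor scale (xs @ w # ys)"
      using VK.linear_add[OF lin] by (simp add: pure_tensor_def fun_eq_iff)
    show "pure_tensor scale (xs @ scale c v # ys)
      = tensor_scale c (pure_tensor scale (xs @ v # ys))"
      using VK.linear_scale[OF lin] by (simp add: pure_tensor_def tensor_scale_def fun_eq_iff)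
  qed
qed

lemma tensor_mult_pure:
  "tensor_mult scale (pure_tensor scale xs) (pure_tensor scale ys) = pure_tensor scale (xs @ ys)"
proof (rule ext)
  fix \<phi>
  show "tensor_mult scale (pure_tensor scale xs) (pure_tensor scale ys) \<phi>
        = pure_tensor scale (xs @ ys) \<phi>"
  proof (cases "\<phi> \<in> multilinear_forms scale")
    case True
    then have lin: "Vector_Spaces.linear scale (*) (\<lambda>v. \<phi> (as @ v # bs))" for as bs
      by (simp add: multilinear_forms_def)
    have "(\<lambda>bs. \<phi> (as @ bs)) \<in> multilinear_forms scale" for as
      using lin[of "as @ _"] by (auto simp: multilinear_forms_def)
    moreover have "(\<lambda>as. \<phi> (as @ ys)) \<in> multilinear_forms scale"
      using lin by (auto simp: multilinear_forms_def)
    ultimately show ?thesis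
      using True by (simp add: tensor_mult_def pure_tensor_def)
  qed (simp add: tensor_mult_def pure_tensor_def)
qed

lemma tensor_mult_linear_left:
  "Vector_Spaces.linear tensor_scale tensor_scale (\<lambda>s. tensor_mult scale s t)"
  by (rule linear_checkI[OF tensor.vector_space_axioms tensor.vector_space_axioms])
     (auto simp: tensor_mult_def tensor_scale_def fun_eq_iff)

lemma tensor_power_linear_on_forms:
  assumes V: "vector_space scale" and s: "s \<in> tensor_power scale m"
    and "\<phi> \<in> multilinear_forms scale" "\<psi> \<in> multilinear_forms scale"
  shows "(\<lambda>xs. a * \<phi> xs + b * \<psi> xs) \<in> multilinear_forms scale"
    and "s (\<lambda>xs. a * \<phi> xs + b * \<psi> xs) = a * s \<phi> + b * s \<psi>"
proof -
  interpret VK: vector_space_pair scale "(*)"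
    by (intro vector_space_pair.intro vector_space_field V)
  show form: "(\<lambda>xs. a * \<phi> xs + b * \<psi> xs) \<in> multilinear_forms scale"
    using assms(3,4) by (auto simp: multilinear_forms_def
      intro!: VK.linear_compose_add VK.linear_compose_scale_right)
  show "s (\<lambda>xs. a * \<phi> xs + b * \<psi> xs) = a * s \<phi> + b * s \<psi>"
    using s unfolding tensor_power_def
  proof (induction rule: tensor.span_induct_alt)
    case base
    show ?case by simp
  next
    case (step c p t)
    have "p (\<lambda>xs. a * \<phi> xs + b * \<psi> xs) = a * p \<phi> + b * p \<psi>"
      using step(1) form assms(3,4) by (auto simp: pure_tensor_def)
    then show ?case
      using step(2) by (simp add: tensor_scale_def distrib_left mult.left_commute)
  qed
qed

lemma tensor_contract_right:
  assumes V: "vector_space scale" and t: "t \<in> tensor_power scale j"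
    and \<phi>: "\<phi> \<in> multilinear_forms scale"
  shows "(\<lambda>xs. t (\<lambda>ys. \<phi> (xs @ ys))) \<in> multilinear_forms scale"
proof -
  interpret VK: vector_space_pair scale "(*)"
    by (intro vector_space_pair.intro vector_space_field V)
  have lin: "Vector_Spaces.linear scale (*) (\<lambda>v. \<phi> (as @ v # bs))" for as bs
    using \<phi> by (simp add: multilinear_forms_def)
  have form: "(\<lambda>ys. \<phi> (as @ ys)) \<in> multilinear_forms scale" for as
    using lin[of "as @ _"] by (auto simp: multilinear_forms_def)
  have "Vector_Spaces.linear scale (*) (\<lambda>v. t (\<lambda>ys. \<phi> ((as @ v # bs) @ ys)))" for as bs
  proof (rule linear_checkI[OF V vector_space_field])
    fix v w c
    have "t (\<lambda>ys. 1 * \<phi> ((as @ v # bs) @ ys) + 1 * \<phi> ((as @ w # bs) @ ys))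
      = 1 * t (\<lambda>ys. \<phi> ((as @ v # bs) @ ys)) + 1 * t (\<lambda>ys. \<phi> ((as @ w # bs) @ ys))"
      by (rule tensor_power_linear_on_forms[OF V t form form])
    then show "t (\<lambda>ys. \<phi> ((as @ (v + w) # bs) @ ys))
      = t (\<lambda>ys. \<phi> ((as @ v # bs) @ ys)) + t (\<lambda>ys. \<phi> ((as @ w # bs) @ ys))"
      by (simp add: VK.linear_add[OF lin])
    have "t (\<lambda>ys. c * \<phi> ((as @ v # bs) @ ys) + 0 * \<phi> ((as @ v # bs) @ ys))
      = c * t (\<lambda>ys. \<phi> ((as @ v # bs) @ ys)) + 0 * t (\<lambda>ys. \<phi> ((as @ v # bs) @ ys))"
      by (rule tensor_power_linear_on_forms[OF V t form form])
    then show "t (\<lambda>ys. \<phi> ((as @ scale c v # bs) @ ys)) = c * t (\<lambda>ys. \<phi> ((as @ v # bs) @ ys))"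
      by (simp add: VK.linear_scale[OF lin])
  qed
  then show ?thesis
    by (simp add: multilinear_forms_def)
qed

lemma tensor_mult_linear_right:
  assumes V: "vector_space scale" and "s \<in> tensor_power scale i"
    and "t \<in> tensor_power scale j" "u \<in> tensor_power scale j"
  shows "tensor_mult scale s (tensor_scale a t + tensor_scale b u)
    = tensor_scale a (tensor_mult scale s t) + tensor_scale b (tensor_mult scale s u)"
proof (rule ext)
  fix \<phi>
  show "tensor_mult scale s (tensor_scale a t + tensor_scale b u) \<phi>
    = (tensor_scale a (tensor_mult scale s t) + tensor_scale b (tensor_mult scale s u)) \<phi>"
  proof (cases "\<phi> \<in> multilinear_forms scale")
    case True
    with tensor_power_linear_on_forms(2)[OF V assms(2)
        tensor_contract_right[OF V assms(3) True] tensor_contract_right[OF V assms(4) True], of a b]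
    show ?thesis
      by (simp add: tensor_mult_def tensor_scale_def)
  qed (simp add: tensor_mult_def tensor_scale_def)
qed

text \<open>Universal property of the tensor power with respect to multilinear maps into any space.\<close>

theorem tensor_power_universal:
  fixes scale :: "'k::field \<Rightarrow> 'v::ab_group_add \<Rightarrow> 'v"
    and scaleW :: "'k \<Rightarrow> 'w::ab_group_add \<Rightarrow> 'w"
  assumes V: "vector_space scale" and W: "vector_space scaleW"
    and g: "\<And>xs ys. Suc (length xs + length ys) = m \<Longrightarrow>
              Vector_Spaces.linear scale scaleW (\<lambda>v. g (xs @ v # ys))"
  shows "\<exists>h. Vector_Spaces.linear tensor_scale scaleW h \<and>
             (\<forall>vs. length vs = m \<longrightarrow> h (pure_tensor scale vs) = g vs)"
proof -
  define P where "P = pure_tensor scale ` {vs. length vs = m}"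
  interpret W: vector_space scaleW by (rule W)
  interpret TW: vector_space_pair "tensor_scale :: 'k \<Rightarrow> ('k, 'v) tensor \<Rightarrow> _" scaleW
    by (intro vector_space_pair.intro W tensor.vector_space_axioms)
  interpret TK: vector_space_pair "tensor_scale :: 'k \<Rightarrow> ('k, 'v) tensor \<Rightarrow> _" "(*) :: 'k \<Rightarrow> 'k \<Rightarrow> 'k"
    by (intro vector_space_pair.intro vector_space_field tensor.vector_space_axioms)
  interpret WK: vector_space_pair scaleW "(*) :: 'k \<Rightarrow> 'k \<Rightarrow> 'k"
    by (intro vector_space_pair.intro vector_space_field W)
  interpret VK: vector_space_pair scale "(*) :: 'k \<Rightarrow> 'k \<Rightarrow> 'k"
    by (intro vector_space_pair.intro vector_space_field V)
  obtain B where B: "B \<subseteq> P" "tensor.independent B" "P \<subseteq> tensor.span B"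
    by (rule tensor.maximal_independent_subset)
  then have "\<forall>b\<in>B. \<exists>vs. length vs = m \<and> b = pure_tensor scale vs"
    by (auto simp: P_def)
  then obtain r where r: "\<And>b. b \<in> B \<Longrightarrow> length (r b) = m \<and> b = pure_tensor scale (r b)"
    by metis
  obtain h where h: "Vector_Spaces.linear tensor_scale scaleW h" "\<And>b. b \<in> B \<Longrightarrow> h b = g (r b)"
    using TW.linear_independent_extend[OF B(2), of "\<lambda>b. g (r b)"] by blast
  have "h (pure_tensor scale vs) = g vs" if len: "length vs = m" for vs
  proof (rule ccontr)
    assume "h (pure_tensor scale vs) \<noteq> g vs"
    then have "W.independent {h (pure_tensor scale vs) - g vs}"
      by simp
    then obtain l where l: "Vector_Spaces.linear scaleW (*) l"
        "l (h (pure_tensor scale vs) - g vs) = 1"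
      using WK.linear_independent_extend[of "{h (pure_tensor scale vs) - g vs}" "\<lambda>_. 1"] by auto
    define \<phi> where "\<phi> = (\<lambda>us. if length us = m then l (g us) else 0)"
    have "Vector_Spaces.linear scale (*) (\<lambda>v. \<phi> (xs @ v # ys))" for xs ys
    proof (cases "Suc (length xs + length ys) = m")
      case True
      from Vector_Spaces.linear_compose[OF g[OF True] l(1)] show ?thesis
        using True by (simp add: \<phi>_def o_def)
    next
      case False
      then show ?thesis
        by (simp add: \<phi>_def VK.linear_zero)
    qed
    then have \<phi>: "\<phi> \<in> multilinear_forms scale"
      by (simp add: multilinear_forms_def)
    have "(l \<circ> h) t = t \<phi>" if "t \<in> tensor.span B" for t
    proof (rule TK.linear_eq_on[OF _ linear_eval that])
      show "Vector_Spaces.linear tensor_scale (*) (l \<circ> h)"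
        by (rule Vector_Spaces.linear_compose[OF h(1) l(1)])
      fix b assume b: "b \<in> B"
      have "b \<phi> = \<phi> (r b)"
        using r[OF b] \<phi> by (metis pure_tensor_def)
      then show "(l \<circ> h) b = b \<phi>"
        using h(2)[OF b] r[OF b] by (simp add: \<phi>_def)
    qed
    from this[of "pure_tensor scale vs"] have "l (h (pure_tensor scale vs)) = l (g vs)"
      using B(3) len \<phi> by (auto simp: P_def pure_tensor_def \<phi>_def)
    with l(2) show False
      by (simp add: WK.linear_diff[OF l(1)])
  qed
  with h(1) show ?thesis by blast
qed

lemma tensor_power_unique:
  fixes scale :: "'k::field \<Rightarrow> 'v::ab_group_add \<Rightarrow> 'v"
    and h h' :: "('k, 'v) tensor \<Rightarrow> 'w::ab_group_add"
  assumes "Vector_Spaces.linear tensor_scale scaleW h" "Vector_Spaces.linear tensor_scale scaleW h'"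
    and "\<And>vs. length vs = m \<Longrightarrow> h (pure_tensor scale vs) = h' (pure_tensor scale vs)"
    and "t \<in> tensor_power scale m"
  shows "h t = h' t"
proof -
  interpret vector_space_pair "tensor_scale :: 'k \<Rightarrow> ('k, 'v) tensor \<Rightarrow> _" scaleW
    using assms(1) unfolding Vector_Spaces.linear_def vector_space_pair_def by blast
  show ?thesis
  proof (rule linear_eq_on[OF assms(1,2)])
    show "t \<in> tensor.span (pure_tensor scale ` {vs. length vs = m})"
      using assms(4) by (simp only: tensor_power_def)
  qed (use assms(3) in blast)
qed


section \<open>Distributive homogeneous algebras\<close>

text \<open>
  In the lattice of subspaces the infimum is the intersection and the supremum is the sum
  \<open>E + F = {x + y | x y. x \<in> E \<and> y \<in> F}\<close>.
\<close>

inductive_set sublattice_generated :: "'a::plus set set \<Rightarrow> 'a set set"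
  for \<G> :: "'a set set" where
  generator: "E \<in> \<G> \<Longrightarrow> E \<in> sublattice_generated \<G>"
| inf: "E \<in> sublattice_generated \<G> \<Longrightarrow> F \<in> sublattice_generated \<G> \<Longrightarrow>
    E \<inter> F \<in> sublattice_generated \<G>"
| sup: "E \<in> sublattice_generated \<G> \<Longrightarrow> F \<in> sublattice_generated \<G> \<Longrightarrow>
    E + F \<in> sublattice_generated \<G>"

definition distributive_triple :: "'a::plus set \<Rightarrow> 'a set \<Rightarrow> 'a set \<Rightarrow> bool" where
  "distributive_triple E F G \<longleftrightarrow> E \<inter> (F + G) = (E \<inter> F) + (E \<inter> G)"

definition distributive_lattice_of_subspaces :: "'a::plus set set \<Rightarrow> bool" where
  "distributive_lattice_of_subspaces \<L> \<longleftrightarrow> (\<forall>E\<in>\<L>. \<forall>F\<in>\<L>. \<forall>G\<in>\<L>. distributive_triple E F G)"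

definition relation_subspaces ::
    "('k::field \<Rightarrow> 'v::ab_group_add \<Rightarrow> 'v) \<Rightarrow> nat \<Rightarrow> ('k, 'v) tensor set \<Rightarrow> nat \<Rightarrow>
     ('k, 'v) tensor set set" where
  "relation_subspaces scale N R m =
     {subspace_tensor scale (tensor_power scale i) (subspace_tensor scale R (tensor_power scale j))
      | i j. i + N + j = m}"

text \<open>
  Distributivity of the \<open>N\<close>-homogeneous algebra \<open>A(V,R) = T(V)/I(R)\<close>, for a subspace \<open>R\<close> of
  the \<open>N\<close>-th tensor power of \<open>V\<close>. It is a property of the data \<open>(V, N, R)\<close> presenting the algebra.
\<close>

definition distributive_homogeneous_algebra ::
    "('k::field \<Rightarrow> 'v::ab_group_add \<Rightarrow> 'v) \<Rightarrow> nat \<Rightarrow> ('k, 'v) tensor set \<Rightarrow> bool" where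
  "distributive_homogeneous_algebra scale N R \<longleftrightarrow>
     (\<forall>m. distributive_lattice_of_subspaces
            (sublattice_generated (relation_subspaces scale N R m)))"

end

theory Submission
  imports Defs
begin

text \<open>
  Subspaces spanned by parts of one common basis generate a distributive lattice. So it suffices
  to find a basis of \<open>V\<^sup>\<otimes>\<^sup>m\<close> such that every \<open>V\<^sup>\<otimes>\<^sup>i \<otimes> f \<otimes> V\<^sup>\<otimes>\<^sup>j\<close> is spanned by some of its
  elements.

  If \<open>V\<close> has an ordered basis in which the leading monomial of \<open>f\<close> is a product \<open>x y\<close> of two
  \<^emph>\<open>different\<close> letters, then occurrences of \<open>x y\<close> in a word never overlap, and replacing each of
  them by \<open>f\<close> turns the basis of words into one of the required kind. Over a field that is not
  algebraically closed no such basis of \<open>V\<close> need exist: for \<open>f = x x + y y\<close> over the reals the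
  square of the first letter occurs in \<open>f\<close> whatever basis is used. However, the subspaces
  \<open>V\<^sup>\<otimes>\<^sup>i \<otimes> f \<otimes> V\<^sup>\<otimes>\<^sup>j\<close> only see \<open>V\<^sup>\<otimes>\<^sup>m\<close> as a product of \<open>m\<close> vector spaces, and each factor, called
  a slot below, may be given a basis of its own. Slot \<open>j\<close> gets a basis \<open>E\<^sub>j\<close> with two different
  elements \<open>x\<^sub>j\<close> and \<open>y\<^sub>j\<close>, such that
  \<open>f - x\<^sub>j \<otimes> y\<^sub>j\<^sub>+\<^sub>1\<close> lies in \<open>span (E\<^sub>j - {x\<^sub>j}) \<otimes> V\<close>.
  Since \<open>x\<^sub>j \<noteq> y\<^sub>j\<close>, the leading terms at neighbouring positions still do not overlap. The
  substituted words span \<open>V\<^sup>\<otimes>\<^sup>m\<close> (\<open>span_subst_words\<close>); there are at most \<open>(dim V)\<^sup>m\<close> of them, so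
  they are independent; and they are multiplicative around an inserted \<open>f\<close>
  (\<open>subst_word_append\<close>), which exhibits each \<open>V\<^sup>\<otimes>\<^sup>i \<otimes> f \<otimes> V\<^sup>\<otimes>\<^sup>j\<close> as the span of some of them.

  The bases are chosen slot by slot. Given \<open>y\<^sub>j \<noteq> 0\<close>, extend it to a basis and write \<open>f\<close> as the
  sum of \<open>a \<otimes> z\<^sub>a\<close> over the basis vectors \<open>a\<close>. Unless \<open>f = y\<^sub>j \<otimes> z\<close> for some \<open>z\<close>,
  some \<open>z\<^sub>a\<close> with \<open>a \<noteq> y\<^sub>j\<close> is nonzero, and \<open>x\<^sub>j = a\<close>, \<open>y\<^sub>j\<^sub>+\<^sub>1 = z\<^sub>a\<close> works
  (\<open>leading_step_exists\<close>). This settles all \<open>f\<close> that are not of the form \<open>u \<otimes> v\<close>. If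
  \<open>f = u \<otimes> v\<close> with \<open>u\<close> and \<open>v\<close> independent, \<open>x = u\<close> and \<open>y = v\<close> work in every slot; if they
  are proportional, \<open>f\<close> is a multiple of \<open>u \<otimes> u\<close> and the words in a basis containing \<open>u\<close> need no
  substitution at all.
\<close>

section \<open>Lattices of subspaces with a common adapted basis\<close>

text \<open>
  A vector of both spans has the same coordinates with respect to \<open>S\<close>, to \<open>T\<close> and to \<open>B\<close>, so its
  support lies in \<open>S\<close> and in \<open>T\<close>.
\<close>
lemma (in vector_space) span_Int_independent:
  assumes "independent B" "S \<subseteq> B" "T \<subseteq> B"
  shows "span S \<inter> span T = span (S \<inter> T)"
proof
  show "span S \<inter> span T \<subseteq> span (S \<inter> T)"
  proof
    fix v assume v: "v \<in> span S \<inter> span T"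
    have S: "representation B v = representation S v"
      and T: "representation B v = representation T v"
      using v assms by (auto intro: representation_extend)
    have "b \<in> S \<inter> T" if "representation B v b \<noteq> 0" for b
      using that representation_ne_zero[of S v b] representation_ne_zero[of T v b]
      unfolding S[symmetric] T[symmetric] by blast
    then have "(\<Sum>b | representation B v b \<noteq> 0. scale (representation B v b) b) \<in> span (S \<inter> T)"
      by (intro span_sum span_scale span_base) blast
    moreover have "v \<in> span B"
      using v assms(2) span_mono by blast
    then have "(\<Sum>b | representation B v b \<noteq> 0. scale (representation B v b) b) = v"
      by (rule sum_nonzero_representation_eq[OF assms(1)])
    ultimately show "v \<in> span (S \<inter> T)"
      by simp
  qed
qed (simp add: span_mono)

lemma (in vector_space) span_plus_span: "span S + span T = span (S \<union> T)"
  by (auto simp: span_Un set_plus_def)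

text \<open>
  Taking spans turns unions and, by independence, intersections of subsets of \<open>B\<close> into
  sums and intersections of subspaces; so the lattice generated is a homomorphic image of a
  lattice of sets.
\<close>
lemma (in vector_space) distributive_lattice_adapted_basis:
  assumes B: "independent B" and gen: "\<And>W. W \<in> \<G> \<Longrightarrow> \<exists>S\<subseteq>B. W = span S"
  shows "distributive_lattice_of_subspaces (sublattice_generated \<G>)"
proof -
  have adapted: "\<exists>S\<subseteq>B. W = span S" if "W \<in> sublattice_generated \<G>" for W
    using that
  proof induction
    case (inf E F)
    then obtain S T where "S \<subseteq> B" "T \<subseteq> B" "E = span S" "F = span T"
      by blast
    then show ?case
      using span_Int_independent[OF B, of S T] by blast
  next
    case (sup E F)
    then obtain S T where "S \<subseteq> B" "T \<subseteq> B" "E = span S" "F = span T"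
      by blast
    then show ?case
      using span_plus_span[of S T] by blast
  qed (rule gen)
  have "distributive_triple E F G"
    if EFG: "E \<in> sublattice_generated \<G>" "F \<in> sublattice_generated \<G>" "G \<in> sublattice_generated \<G>"
    for E F G
  proof -
    obtain S T U where "S \<subseteq> B" "T \<subseteq> B" "U \<subseteq> B" "E = span S" "F = span T" "G = span U"
      using EFG[THEN adapted] by blast
    then show ?thesis
      using span_Int_independent[OF B, of S]
      by (simp add: distributive_triple_def span_plus_span Int_Un_distrib)
  qed
  then show ?thesis
    by (simp add: distributive_lattice_of_subspaces_def)
qed


section \<open>The product of tensors\<close>

lemma tensor_power_zero_off_forms:
  assumes "t \<in> tensor_power scale m" "\<phi> \<notin> multilinear_forms scale"
  shows "t \<phi> = 0"
  using assms(1) unfolding tensor_power_def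
  by (induction rule: tensor.span_induct_alt) (use assms(2) in \<open>auto simp: pure_tensor_def tensor_scale_def\<close>)

lemma pure_tensor_in_power: "length vs = m \<Longrightarrow> pure_tensor scale vs \<in> tensor_power scale m"
  unfolding tensor_power_def by (rule tensor.span_base) auto

lemma subspace_tensor_power: "tensor.subspace (tensor_power scale m)"
  unfolding tensor_power_def by (rule tensor.subspace_span)

text \<open>
  A locale of its own keeps the short notation for tensors out of \<open>vector_space\<close>, whose many
  existing interpretations would otherwise inherit it.
\<close>
locale tensor_products = vector_space scale
  for scale :: "'k::field \<Rightarrow> 'v::ab_group_add \<Rightarrow> 'v"
begin

abbreviation tprod (infixr "\<cdot>" 70) where "s \<cdot> t \<equiv> tensor_mult scale s t"

abbreviation pure where "pure \<equiv> pure_tensor scale"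

abbreviation tpow where "tpow \<equiv> tensor_power scale"

lemma tprod_left:
  fixes s s' t :: "('k, 'v) tensor"
  shows "(s + s') \<cdot> t = s \<cdot> t + s' \<cdot> t" "(s - s') \<cdot> t = s \<cdot> t - s' \<cdot> t"
  "tensor_scale c s \<cdot> t = tensor_scale c (s \<cdot> t)" "0 \<cdot> t = 0"
  by (auto simp: tensor_mult_def tensor_scale_def fun_eq_iff)

lemma tprod_right:
  fixes s t u :: "('k, 'v) tensor"
  assumes "s \<in> tpow i"
  shows "t \<in> tpow j \<Longrightarrow> u \<in> tpow j \<Longrightarrow>
    s \<cdot> (tensor_scale c t + u) = tensor_scale c (s \<cdot> t) + s \<cdot> u"
    and "s \<cdot> 0 = 0"
proof -
  show "s \<cdot> (tensor_scale c t + u) = tensor_scale c (s \<cdot> t) + s \<cdot> u"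
    if "t \<in> tpow j" "u \<in> tpow j"
    using tensor_mult_linear_right[OF vector_space_axioms assms that, of c 1] by simp
  show "s \<cdot> 0 = 0"
    using tensor_mult_linear_right[OF vector_space_axioms assms, of 0 0 0 0 0]
    by (simp add: tensor.subspace_0[OF subspace_tensor_power])
qed

text \<open>
  Additivity on the right comes from the additivity of \<open>s\<close> on multilinear forms, applied to
  contractions of a form with elements of \<open>T\<close>; the degree assumptions provide both.
\<close>
lemma tprod_span:
  assumes S: "S \<subseteq> tpow i" and T: "T \<subseteq> tpow j"
    and s: "s \<in> tensor.span S" and t: "t \<in> tensor.span T"
  shows "s \<cdot> t \<in> tensor.span {a \<cdot> b | a b. a \<in> S \<and> b \<in> T}"
proof -
  have gen: "a \<cdot> t \<in> tensor.span {a \<cdot> b | a b. a \<in> S \<and> b \<in> T}" if a: "a \<in> S" for a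
  proof -
    note a' = subsetD[OF S a]
    (* The degree of t is carried along, because additivity on the right asks for it. *)
    have "t \<in> tpow j \<and> ?thesis"
      using t
    proof (induction rule: tensor.span_induct_alt)
      case base
      show ?case
        unfolding tprod_right(2)[OF a']
        by (intro conjI tensor.span_zero tensor.subspace_0[OF subspace_tensor_power])
    next
      case (step c x y)
      have x: "x \<in> tpow j"
        using step(1) T by blast
      have ax: "a \<cdot> x \<in> tensor.span {a \<cdot> b | a b. a \<in> S \<and> b \<in> T}"
        using a step(1) by (blast intro: tensor.span_base)
      have eq: "a \<cdot> (tensor_scale c x + y) = tensor_scale c (a \<cdot> x) + a \<cdot> y"
        using tprod_right(1)[OF a' x] step(2) by blast
      show ?case
        unfolding eq using x ax step(2)
        by (intro conjI tensor.span_add tensor.span_scale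
            tensor.subspace_add tensor.subspace_scale subspace_tensor_power) blast+
    qed
    then show ?thesis ..
  qed
  show ?thesis
    using s
  proof (induction rule: tensor.span_induct_alt)
    case base
    show ?case
      unfolding tprod_left by (rule tensor.span_zero)
  next
    case (step c x y)
    then show ?case
      unfolding tprod_left by (intro tensor.span_add[OF tensor.span_scale[OF gen]]) auto
  qed
qed

lemma tprod_power:
  assumes "s \<in> tpow i" "t \<in> tpow j"
  shows "s \<cdot> t \<in> tpow (i + j)"
proof -
  let ?P = "\<lambda>m. pure ` {vs. length vs = m}"
  have "s \<cdot> t \<in> tensor.span {a \<cdot> b | a b. a \<in> ?P i \<and> b \<in> ?P j}"
    by (rule tprod_span[of _ i _ j])
       (use assms in \<open>auto simp: pure_tensor_in_power tensor_power_def[symmetric]\<close>)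
  also have "\<dots> \<subseteq> tpow (i + j)"
    by (rule tensor.span_minimal[OF _ subspace_tensor_power])
       (auto simp: tensor_mult_pure intro!: pure_tensor_in_power)
  finally show ?thesis .
qed

lemma subspace_tensor_span:
  assumes "S \<subseteq> tpow i" "T \<subseteq> tpow j"
  shows "subspace_tensor scale (tensor.span S) (tensor.span T)
    = tensor.span {a \<cdot> b | a b. a \<in> S \<and> b \<in> T}"
  unfolding subspace_tensor_def
proof
  show "tensor.span {s \<cdot> t | s t. s \<in> tensor.span S \<and> t \<in> tensor.span T}
    \<subseteq> tensor.span {a \<cdot> b | a b. a \<in> S \<and> b \<in> T}"
    by (rule tensor.span_minimal) (use tprod_span[OF assms] in auto)
  show "tensor.span {a \<cdot> b | a b. a \<in> S \<and> b \<in> T}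
    \<subseteq> tensor.span {s \<cdot> t | s t. s \<in> tensor.span S \<and> t \<in> tensor.span T}"
    by (rule tensor.span_mono) (auto intro: tensor.span_base)
qed

text \<open>
  Products are \<open>0\<close> off the multilinear forms by definition. The degree of \<open>u\<close> ensures that the
  contraction of a multilinear form with \<open>u\<close> is a multilinear form again, so that this default
  value does not interfere with \<open>s \<cdot> t\<close>.
\<close>
lemma tprod_assoc:
  assumes "u \<in> tpow j"
  shows "(s \<cdot> t) \<cdot> u = s \<cdot> (t \<cdot> u)"
proof (rule ext)
  fix \<phi>
  show "((s \<cdot> t) \<cdot> u) \<phi> = (s \<cdot> (t \<cdot> u)) \<phi>"
  proof (cases "\<phi> \<in> multilinear_forms scale")
    case True
    then have lin: "Vector_Spaces.linear scale (*) (\<lambda>v. \<phi> (as @ v # bs))" for as bs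
      by (simp add: multilinear_forms_def)
    have "(\<lambda>bs. \<phi> (as @ bs)) \<in> multilinear_forms scale" for as
      using lin[of "as @ _"] by (auto simp: multilinear_forms_def)
    with True show ?thesis
      using tensor_contract_right[OF vector_space_axioms assms True] by (simp add: tensor_mult_def)
  qed (simp add: tensor_mult_def)
qed

lemma tprod_unit:
  assumes "t \<in> tpow j"
  shows "pure [] \<cdot> t = t"
proof (rule ext)
  fix \<phi>
  show "(pure [] \<cdot> t) \<phi> = t \<phi>"
    using tensor_contract_right[OF vector_space_axioms assms, of \<phi>]
      tensor_power_zero_off_forms[OF assms, of \<phi>]
    by (simp add: tensor_mult_def pure_tensor_def)
qed

lemma pure_linear:
  "pure (us @ (v + w) # vs) = pure (us @ v # vs) + pure (us @ w # vs)"
  "pure (us @ scale c v # vs) = tensor_scale c (pure (us @ v # vs))"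
  "pure (us @ 0 # vs) = 0"
proof -
  interpret VT: vector_space_pair scale "tensor_scale :: 'k \<Rightarrow> ('k, 'v) tensor \<Rightarrow> _"
    by (intro vector_space_pair.intro vector_space_axioms tensor.vector_space_axioms)
  note lin = pure_tensor_multilinear[OF vector_space_axioms, of us vs]
  show "pure (us @ (v + w) # vs) = pure (us @ v # vs) + pure (us @ w # vs)"
    "pure (us @ scale c v # vs) = tensor_scale c (pure (us @ v # vs))"
    "pure (us @ 0 # vs) = 0"
    by (rule VT.linear_add[OF lin] VT.linear_scale[OF lin] VT.linear_0[OF lin])+
qed

lemma pure_Cons: "pure (v # vs) = pure [v] \<cdot> pure vs"
  by (simp add: tensor_mult_pure)

lemma pure_tprod_in_span_if_on_generators:
  assumes v: "v \<in> span A" and A: "\<And>a. a \<in> A \<Longrightarrow> pure [a] \<cdot> t \<in> tensor.span S"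
  shows "pure [v] \<cdot> t \<in> tensor.span S"
  using v
proof (induction rule: span_induct_alt)
  case base
  show ?case
    using pure_linear(3)[of "[]" "[]"] by (simp only: append_Nil tensor.span_zero tprod_left)
next
  case (step c a v)
  have "pure [scale c a + v] \<cdot> t = tensor_scale c (pure [a] \<cdot> t) + pure [v] \<cdot> t"
    using pure_linear(1)[of "[]" "scale c a" v "[]"] pure_linear(2)[of "[]" c a "[]"]
    by (simp only: append_Nil tprod_left)
  then show ?case
    using tensor.span_add[OF tensor.span_scale[OF A[OF step(1)]] step(2)] by (simp only:)
qed

end


section \<open>The dimension of a tensor power\<close>

locale finite_tensor_products = finite_dimensional_vector_space scale Basis + tensor_products scale
  for scale :: "'k::field \<Rightarrow> 'v::ab_group_add \<Rightarrow> 'v" and Basis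
begin

text \<open>
  For \<open>bs\<close> with letters in \<open>Basis\<close>, this is the coefficient of the word \<open>bs\<close>.
\<close>
fun dual_form :: "'v list \<Rightarrow> 'v list \<Rightarrow> 'k" where
  "dual_form [] [] = 1"
| "dual_form (b # bs) (v # vs) = representation Basis v b * dual_form bs vs"
| "dual_form _ _ = 0"

lemma dual_form_multilinear: "dual_form bs \<in> multilinear_forms scale"
proof -
  interpret VK: vector_space_pair scale "(*) :: 'k \<Rightarrow> 'k \<Rightarrow> 'k"
    by (intro vector_space_pair.intro vector_space_axioms vector_space_field)
  have rep: "Vector_Spaces.linear scale (*) (\<lambda>v. representation Basis v b)" for b
    by (rule linear_representation[OF independent_Basis span_Basis])
  have "Vector_Spaces.linear scale (*) (\<lambda>v. dual_form bs (xs @ v # ys))" for xs ys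
  proof (induction bs arbitrary: xs)
    case Nil
    have "dual_form [] (xs @ v # ys) = 0" for v
      by (cases xs) auto
    then show ?case by (simp add: VK.linear_zero)
  next
    case (Cons b bs)
    show ?case
    proof (cases xs)
      case Nil
      then show ?thesis
        using VK.linear_compose_scale_right[OF rep, of "dual_form bs ys" b] by (simp add: mult.commute)
    next
      case (Cons x xs')
      then show ?thesis
        using VK.linear_compose_scale_right[OF Cons.IH] by simp
    qed
  qed
  then show ?thesis by (simp add: multilinear_forms_def)
qed

lemma dual_form_basis:
  "set ws \<subseteq> Basis \<Longrightarrow> dual_form bs ws = (if ws = bs then 1 else 0)"
proof (induction bs ws rule: dual_form.induct)
  case (2 b bs v vs)
  then show ?case
    by (auto simp: representation_basis[OF independent_Basis])
qed auto

lemma independent_pure_basis: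
  defines "W m \<equiv> {w. set w \<subseteq> Basis \<and> length w = m}"
  shows "tensor.independent (pure ` W m)" and "card (pure ` W m) = card Basis ^ m"
proof -
  have eval: "pure w (dual_form v) = (if w = v then 1 else 0)" if "w \<in> W m" for v w
    using that by (simp add: pure_tensor_def dual_form_multilinear dual_form_basis W_def)
  show "tensor.independent (pure ` W m)"
    unfolding tensor.dependent_def
  proof safe
    fix w assume w: "w \<in> W m" and dep: "pure w \<in> tensor.span (pure ` W m - {pure w})"
    have "t (dual_form w) = 0" if "t \<in> tensor.span (pure ` W m - {pure w})" for t
      using that
    proof (induction rule: tensor.span_induct_alt)
      case (step c x y)
      then obtain v where "v \<in> W m" "x = pure v" "v \<noteq> w" by blast
      then have "x (dual_form w) = 0"
        by (simp add: eval)
      with step(2) show ?case by (simp add: tensor_scale_def)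
    qed simp
    from this[OF dep] show False by (simp add: eval[OF w])
  qed
  have "inj_on pure (W m)"
    by (rule inj_onI) (metis eval zero_neq_one)
  then show "card (pure ` W m) = card Basis ^ m"
    by (simp add: card_image W_def card_lists_length_eq finite_Basis)
qed

text \<open>
  The words in \<open>Basis\<close> show that \<open>V\<^sup>\<otimes>\<^sup>m\<close> has dimension at least \<open>(dim V)\<^sup>m\<close>, so a spanning set of
  that size has no element to spare.
\<close>
lemma independent_if_few_spanning:
  assumes "finite B" "card B \<le> card Basis ^ m" "tensor.span B = tpow m"
  shows "tensor.independent B"
proof
  assume "tensor.dependent B"
  then obtain b where b: "b \<in> B" "b \<in> tensor.span (B - {b})"
    by (auto simp: tensor.dependent_def)
  then have "tensor.span (B - {b}) = tpow m"
    using tensor.span_redundant[OF b(2)] by (simp add: insert_absorb assms(3))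
  then have "pure ` {w. set w \<subseteq> Basis \<and> length w = m} \<subseteq> tensor.span (B - {b})"
    by (auto intro: pure_tensor_in_power)
  then have "card Basis ^ m \<le> card (B - {b})"
    using tensor.independent_span_bound[OF _ independent_pure_basis(1), of "B - {b}" m] assms(1)
    by (auto simp: independent_pure_basis(2))
  also have "\<dots> < card B"
    using b(1) assms(1) by (rule card_Diff1_less[rotated])
  finally show False using assms(2) by simp
qed

text \<open>
  The index \<open>j\<close> of \<open>\<B> j m\<close> is the slot at which the tensors begin, and \<open>m\<close> is their degree. As
  \<open>\<B> 0 i\<close> and \<open>\<B> (i + 2) j\<close> span the outer factors, the products \<open>a \<cdot> r \<cdot> b\<close> span
  \<open>V\<^sup>\<otimes>\<^sup>i \<otimes> r \<otimes> V\<^sup>\<otimes>\<^sup>j\<close>, and these products belong to the single basis \<open>\<B> 0 (i + 2 + j)\<close>.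
\<close>
lemma distributive_if_multiplicative_bases:
  assumes r: "r \<in> tpow 2"
    and fin: "\<And>m. finite (\<B> 0 m) \<and> card (\<B> 0 m) \<le> card Basis ^ m"
    and span: "\<And>j m. tensor.span (\<B> j m) = tpow m"
    and mult: "\<And>i j a b. a \<in> \<B> 0 i \<Longrightarrow> b \<in> \<B> (i + 2) j \<Longrightarrow> a \<cdot> r \<cdot> b \<in> \<B> 0 (i + 2 + j)"
  shows "distributive_homogeneous_algebra scale 2 (tensor.span {r})"
  unfolding distributive_homogeneous_algebra_def
proof (rule allI, rule tensor.distributive_lattice_adapted_basis)
  fix m
  show "tensor.independent (\<B> 0 m)"
    using independent_if_few_spanning fin span by blast
  fix W assume "W \<in> relation_subspaces scale 2 (tensor.span {r}) m"
  then obtain i j where m: "i + 2 + j = m"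
    and W: "W = subspace_tensor scale (tpow i) (subspace_tensor scale (tensor.span {r}) (tpow j))"
    by (auto simp: relation_subspaces_def)
  have sub: "\<B> k l \<subseteq> tpow l" for k l
    using tensor.span_superset[of "\<B> k l"] by (simp add: span)
  have "subspace_tensor scale (tensor.span {r}) (tpow j) = tensor.span {r \<cdot> b | b. b \<in> \<B> (i + 2) j}"
    using subspace_tensor_span[of "{r}" 2 "\<B> (i + 2) j" j] r sub by (simp add: span)
  moreover have "{r \<cdot> b | b. b \<in> \<B> (i + 2) j} \<subseteq> tpow (2 + j)"
    using tprod_power[OF r] sub by blast
  ultimately have "W = tensor.span {a \<cdot> c | a c. a \<in> \<B> 0 i \<and> c \<in> {r \<cdot> b | b. b \<in> \<B> (i + 2) j}}"
    using subspace_tensor_span[of "\<B> 0 i" i "{r \<cdot> b | b. b \<in> \<B> (i + 2) j}" "2 + j"] sub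
    by (simp add: span W)
  moreover have "{a \<cdot> c | a c. a \<in> \<B> 0 i \<and> c \<in> {r \<cdot> b | b. b \<in> \<B> (i + 2) j}} \<subseteq> \<B> 0 m"
    using mult m by blast
  ultimately show "\<exists>S\<subseteq>\<B> 0 m. W = tensor.span S" by blast
qed

end


section \<open>Words with a different basis in every slot\<close>

primrec words :: "(nat \<Rightarrow> 'v set) \<Rightarrow> nat \<Rightarrow> nat \<Rightarrow> 'v list set" where
  "words E j 0 = {[]}"
| "words E j (Suc m) = (\<lambda>(c, w). c # w) ` (E j \<times> words E (Suc j) m)"

lemma length_words: "w \<in> words E j m \<Longrightarrow> length w = m"
  by (induction m arbitrary: j w) auto

lemma words_append:
  "u \<in> words E j i \<Longrightarrow> v \<in> words E (j + i) m \<Longrightarrow> u @ v \<in> words E j (i + m)"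
  by (induction i arbitrary: j u) force+

lemma finite_card_words:
  assumes "\<And>j. finite (E j) \<and> card (E j) = n"
  shows "finite (words E j m) \<and> card (words E j m) \<le> n ^ m"
proof (induction m arbitrary: j)
  case (Suc m)
  have "card (words E j (Suc m)) \<le> card (E j \<times> words E (Suc j) m)"
    using assms Suc by (simp only: words.simps) (intro card_image_le finite_cartesian_product; simp)
  also have "\<dots> \<le> n * n ^ m"
    using assms Suc by (simp add: card_cartesian_product)
  finally show ?case using assms Suc by simp
qed simp

context finite_tensor_products
begin

lemma card_of_basis:
  assumes "independent E" "span E = UNIV"
  shows "finite E \<and> card E = card Basis"
  using assms finiteI_independent basis_card_eq_dim[of E UNIV] by simp

end


section \<open>Substituting the relation into words\<close>

text \<open>
  Read \<open>x j\<close> as the greatest letter of slot \<open>j\<close>: the last assumption says that the part of \<open>f\<close>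
  beginning with this letter is exactly \<open>x j \<otimes> y (Suc j)\<close>. No order is imposed on the other
  letters.
\<close>
locale slotwise_leading_term = finite_tensor_products scale Basis
  for scale :: "'k::field \<Rightarrow> 'v::ab_group_add \<Rightarrow> 'v" and Basis +
  fixes f :: "('k, 'v) tensor" and E :: "nat \<Rightarrow> 'v set" and x y :: "nat \<Rightarrow> 'v"
  assumes f: "f \<in> tpow 2"
    and E: "independent (E j)" "span (E j) = UNIV"
    and xy: "x j \<in> E j" "y j \<in> E j" "x j \<noteq> y j"
    and leading: "f - pure [x j, y (Suc j)] \<in> tensor.span {pure [b, v] | b v. b \<in> E j - {x j}}"
begin

fun subst_word :: "nat \<Rightarrow> 'v list \<Rightarrow> ('k, 'v) tensor" where
  "subst_word j [] = pure []"
| "subst_word j [c] = pure [c]"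
| "subst_word j (c # d # w) =
     (if c = x j \<and> d = y (Suc j) then f \<cdot> subst_word (j + 2) w
      else pure [c] \<cdot> subst_word (Suc j) (d # w))"

lemma subst_word_power: "length w = m \<Longrightarrow> subst_word j w \<in> tpow m"
proof (induction j w arbitrary: m rule: subst_word.induct)
  case (3 j c d w)
  show ?case
  proof (cases "c = x j \<and> d = y (Suc j)")
    case True
    then show ?thesis
      using tprod_power[OF f 3(1)[OF True refl]] 3(3) by simp
  next
    case False
    then show ?thesis
      using tprod_power[OF pure_tensor_in_power[of "[c]" 1] 3(2)[OF False refl]] 3(3) by auto
  qed
qed (auto intro: pure_tensor_in_power)

text \<open>
  The letter before the inserted pair cannot pair up with \<open>x k\<close>, which would have to be \<open>y k\<close>;
  so the scan from the left always arrives at the inserted pair intact.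
\<close>
lemma subst_word_append:
  assumes "k = j + length u"
  shows "subst_word j (u @ x k # y (Suc k) # v) = subst_word j u \<cdot> f \<cdot> subst_word (k + 2) v"
  using assms
proof (induction j u rule: subst_word.induct)
  case (1 j)
  show ?case
    using tprod_unit[OF tprod_power[OF f subst_word_power[OF refl]]] 1 by simp
next
  case (2 j c)
  then show ?case
    using xy(3)[of "Suc j"] by simp
next
  case (3 j c d u)
  note assoc = tprod_assoc[OF tprod_power[OF f subst_word_power[OF refl]]]
  show ?case
  proof (cases "c = x j \<and> d = y (Suc j)")
    case True
    then show ?thesis
      using 3(1)[OF True] 3(3) by (simp add: assoc)
  next
    case False
    then show ?thesis
      using 3(2)[OF False] 3(3) by (auto simp: assoc)
  qed
qed

text \<open>
  Induction on the degree. Left multiplication by a letter \<open>c \<noteq> x j\<close> maps substituted words to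
  substituted words, so all of \<open>c \<otimes> V\<^sup>\<otimes>\<^sup>m\<close> is reached. For \<open>c = x j\<close> the only exceptions are
  words beginning with \<open>y (Suc j)\<close>; there \<open>x j \<otimes> y (Suc j)\<close> is \<open>f\<close> minus tensors that begin with
  letters other than \<open>x j\<close>, and these are already covered.
\<close>
lemma span_subst_words: "tensor.span (subst_word j ` words E j m) = tpow m"
proof
  show "tensor.span (subst_word j ` words E j m) \<subseteq> tpow m"
    by (rule tensor.span_minimal[OF _ subspace_tensor_power])
       (auto intro: subst_word_power length_words)
  show "tpow m \<subseteq> tensor.span (subst_word j ` words E j m)"
  proof (induction m arbitrary: j)
    case 0
    show ?case by (simp add: tensor_power_def)
  next
    case (Suc m)
    let ?S = "tensor.span (subst_word j ` words E j (Suc m))"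
    have IH: "tensor.span (subst_word (Suc j) ` words E (Suc j) m) = tpow m"
      by (intro equalityI Suc tensor.span_minimal subspace_tensor_power)
         (auto intro: subst_word_power length_words)
    have mult: "pure [c] \<cdot> t \<in> ?S"
      if c: "\<And>w. w \<in> words E (Suc j) m \<Longrightarrow> pure [c] \<cdot> subst_word (Suc j) w \<in> ?S"
        and t: "t \<in> tpow m" for c t
    proof -
      have "pure [c] \<cdot> t \<in>
        tensor.span {a \<cdot> b | a b. a \<in> {pure [c]} \<and> b \<in> subst_word (Suc j) ` words E (Suc j) m}"
        by (rule tprod_span[of _ 1 _ m])
           (use t in \<open>auto simp: IH intro: pure_tensor_in_power subst_word_power length_words tensor.span_base\<close>)
      also have "\<dots> \<subseteq> ?S"
        by (rule tensor.span_minimal) (use c in auto)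
      finally show ?thesis .
    qed
    have low: "pure [c] \<cdot> t \<in> ?S" if c: "c \<in> E j - {x j}" and t: "t \<in> tpow m" for c t
    proof (rule mult[OF _ t])
      fix w assume w: "w \<in> words E (Suc j) m"
      then have "c # w \<in> words E j (Suc m)"
        using c by auto
      moreover have "subst_word j (c # w) = pure [c] \<cdot> subst_word (Suc j) w"
        using c by (cases w) (auto simp: tensor_mult_pure)
      ultimately show "pure [c] \<cdot> subst_word (Suc j) w \<in> ?S"
        by (metis image_eqI tensor.span_base)
    qed
    have high: "pure [x j] \<cdot> subst_word (Suc j) w \<in> ?S" if w: "w \<in> words E (Suc j) m" for w
    proof -
      have xw: "subst_word j (x j # w) \<in> ?S"
        using w xy(1)[of j] by (intro tensor.span_base imageI) auto
      show ?thesis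
      proof (cases "\<exists>v. w = y (Suc j) # v")
        case False
        then have "subst_word j (x j # w) = pure [x j] \<cdot> subst_word (Suc j) w"
          by (cases w) (auto simp: tensor_mult_pure)
        with xw show ?thesis by simp
      next
        case True
        then obtain v where v: "w = y (Suc j) # v" ..
        define t where "t = subst_word (j + 2) v"
        have m: "m = Suc (length v)"
          using length_words[OF w] v by simp
        have t: "t \<in> tpow (length v)"
          unfolding t_def by (rule subst_word_power[OF refl])
        (* The letter y differs from x in its slot, so it does not start a replaced pair. *)
        have "subst_word (Suc j) w = pure [y (Suc j)] \<cdot> t"
          using xy(3)[of "Suc j"] by (cases v) (auto simp: v t_def tensor_mult_pure)
        then have "pure [x j] \<cdot> subst_word (Suc j) w = pure [x j, y (Suc j)] \<cdot> t"
          by (simp add: tprod_assoc[OF t, symmetric] tensor_mult_pure)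
        also have "\<dots> = f \<cdot> t - (f - pure [x j, y (Suc j)]) \<cdot> t"
          by (simp add: tprod_left)
        also have "\<dots> \<in> ?S"
        proof (rule tensor.span_diff)
          show "f \<cdot> t \<in> ?S"
            using xw by (simp add: v t_def)
          have "(f - pure [x j, y (Suc j)]) \<cdot> t \<in>
            tensor.span {a \<cdot> b | a b. a \<in> {pure [b, v] | b v. b \<in> E j - {x j}} \<and> b \<in> {t}}"
            by (rule tprod_span[of _ 2 _ "length v"])
               (use t leading[of j] in \<open>auto intro: pure_tensor_in_power tensor.span_base\<close>)
          also have "\<dots> \<subseteq> ?S"
          proof -
            have "pure [b, u] \<cdot> t \<in> ?S" if b: "b \<in> E j - {x j}" for b u
            proof -
              have "pure [b, u] \<cdot> t = pure [b] \<cdot> (pure [u] \<cdot> t)"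
                by (simp add: tprod_assoc[OF t, symmetric] tensor_mult_pure)
              moreover have "pure [u] \<cdot> t \<in> tpow m"
                using tprod_power[OF pure_tensor_in_power[of "[u]" 1] t] by (simp add: m)
              ultimately show ?thesis
                using low[OF b] by simp
            qed
            then show ?thesis
              by (intro tensor.span_minimal[OF _ tensor.subspace_span]) blast
          qed
          finally show "(f - pure [x j, y (Suc j)]) \<cdot> t \<in> ?S" .
        qed
        finally show ?thesis .
      qed
    qed
    have "pure vs \<in> ?S" if "length vs = Suc m" for vs :: "'v list"
    proof -
      from that obtain v ws where vs: "vs = v # ws" and ws: "length ws = m"
        by (cases vs) auto
      have t: "pure ws \<in> tpow m"
        by (rule pure_tensor_in_power[OF ws])
      have "pure [v] \<cdot> pure ws \<in> ?S"
        by (rule pure_tprod_in_span_if_on_generators[of v "E j"])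
           (use low[OF _ t] mult[OF high t] E(2) in auto)
      then show ?thesis
        by (simp add: vs pure_Cons[of v ws])
    qed
    then show ?case
      unfolding tensor_power_def[of scale "Suc m"]
      by (intro tensor.span_minimal[OF _ tensor.subspace_span]) blast
  qed
qed

lemma distributive: "distributive_homogeneous_algebra scale 2 (tensor.span {f})"
proof (rule distributive_if_multiplicative_bases[OF f, where \<B> = "\<lambda>j m. subst_word j ` words E j m"])
  fix m
  have "finite (words E 0 m) \<and> card (words E 0 m) \<le> card Basis ^ m"
    by (rule finite_card_words[OF card_of_basis[OF E]])
  then show "finite (subst_word 0 ` words E 0 m) \<and> card (subst_word 0 ` words E 0 m) \<le> card Basis ^ m"
    by (meson card_image_le finite_imageI le_trans)
next
  fix j m
  show "tensor.span (subst_word j ` words E j m) = tpow m"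
    by (rule span_subst_words)
next
  fix i j a b
  assume "a \<in> subst_word 0 ` words E 0 i" "b \<in> subst_word (i + 2) ` words E (i + 2) j"
  then obtain u v where u: "u \<in> words E 0 i" "a = subst_word 0 u"
    and v: "v \<in> words E (i + 2) j" "b = subst_word (i + 2) v"
    by blast
  have w: "u @ [x i, y (Suc i)] @ v \<in> words E 0 (i + (2 + j))"
    using u v xy by (intro words_append) (auto simp: image_iff numeral_2_eq_2)
  have eq: "subst_word 0 (u @ [x i, y (Suc i)] @ v) = a \<cdot> f \<cdot> b"
    using subst_word_append[of i 0 u v] u v length_words[OF u(1)] by simp
  show "a \<cdot> f \<cdot> b \<in> subst_word 0 ` words E 0 (i + 2 + j)"
    unfolding add.assoc eq[symmetric] using w by (rule imageI)
qed

end

section \<open>Choosing the bases\<close>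

context finite_tensor_products
begin

text \<open>
  For a square \<open>u \<otimes> u\<close> overlaps are harmless: \<open>V\<^sup>\<otimes>\<^sup>i \<otimes> u \<otimes> u \<otimes> V\<^sup>\<otimes>\<^sup>j\<close> is spanned by words in any basis
  that contains \<open>u\<close>.
\<close>
lemma distributive_square:
  assumes "u \<noteq> 0"
  shows "distributive_homogeneous_algebra scale 2 (tensor.span {pure [u, u]})"
proof -
  define A where "A = extend_basis {u}"
  have A: "independent A" "span A = UNIV" "u \<in> A"
    using assms extend_basis_superset[of "{u}"] independent_extend_basis[of "{u}"]
    by (auto simp: A_def)
  show ?thesis
  proof (rule distributive_if_multiplicative_bases[where \<B> = "\<lambda>j m. pure ` words (\<lambda>_. A) j m"])
    show "pure [u, u] \<in> tpow 2"
      by (rule pure_tensor_in_power) simp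
  next
    fix m
    have "finite (words (\<lambda>_. A) 0 m) \<and> card (words (\<lambda>_. A) 0 m) \<le> card Basis ^ m"
      by (rule finite_card_words[OF card_of_basis[OF A(1,2)]])
    then show "finite (pure ` words (\<lambda>_. A) 0 m) \<and> card (pure ` words (\<lambda>_. A) 0 m) \<le> card Basis ^ m"
      by (meson card_image_le finite_imageI le_trans)
  next
    fix j m
    have "pure vs \<in> tensor.span (pure ` words (\<lambda>_. A) j m)" if "length vs = m" for vs :: "'v list"
      using that
    proof (induction vs arbitrary: j m)
      case (Cons v vs)
      let ?S = "pure ` words (\<lambda>_. A) j m"
      have "pure [a] \<cdot> pure vs \<in> tensor.span ?S" if a: "a \<in> A" for a
      proof -
        have "pure [a] \<cdot> pure vs \<in>
          tensor.span {s \<cdot> t | s t. s \<in> {pure [a]} \<and> t \<in> pure ` words (\<lambda>_. A) (Suc j) (length vs)}"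
        proof (rule tprod_span[of _ 1 _ "length vs"])
          show "pure vs \<in> tensor.span (pure ` words (\<lambda>_. A) (Suc j) (length vs))"
            by (rule Cons.IH[OF refl])
        qed (auto intro: pure_tensor_in_power length_words tensor.span_base)
        also have "\<dots> \<subseteq> tensor.span ?S"
          using Cons.prems[symmetric] a by (intro tensor.span_mono) (auto simp: tensor_mult_pure)
        finally show ?thesis .
      qed
      then have "pure [v] \<cdot> pure vs \<in> tensor.span ?S"
        by (intro pure_tprod_in_span_if_on_generators[of v A]) (simp_all add: A(2))
      then show ?case
        by (simp only: pure_Cons[of v vs])
    qed (simp add: tensor.span_base)
    then show "tensor.span (pure ` words (\<lambda>_. A) j m) = tpow m"
      unfolding tensor_power_def
      by (intro equalityI tensor.span_minimal tensor.subspace_span)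
         (auto intro: tensor.span_base length_words)
  next
    fix i j a b
    assume "a \<in> pure ` words (\<lambda>_. A) 0 i" "b \<in> pure ` words (\<lambda>_. A) (i + 2) j"
    then obtain p q where p: "p \<in> words (\<lambda>_. A) 0 i" "a = pure p"
      and q: "q \<in> words (\<lambda>_. A) (i + 2) j" "b = pure q"
      by blast
    have w: "p @ [u, u] @ q \<in> words (\<lambda>_. A) 0 (i + (2 + j))"
      using p q A(3) by (intro words_append) (auto simp: image_iff numeral_2_eq_2)
    have eq: "pure (p @ [u, u] @ q) = a \<cdot> pure [u, u] \<cdot> b"
      by (simp add: p q tensor_mult_pure)
    show "a \<cdot> pure [u, u] \<cdot> b \<in> pure ` words (\<lambda>_. A) 0 (i + 2 + j)"
      unfolding add.assoc eq[symmetric] using w by (rule imageI)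
  qed
qed

lemma tensor_square_expansion:
  assumes A: "finite A" "span A = UNIV" and t: "t \<in> tpow 2"
  shows "\<exists>z. t = (\<Sum>a\<in>A. pure [a, z a])"
proof -
  have pure2: "\<exists>z. pure [v, w] = (\<Sum>a\<in>A. pure [a, z a])" for v w
  proof -
    have "v \<in> span A" using A by simp
    then obtain c where "v = (\<Sum>a\<in>A. scale (c a) a)"
      using span_finite[OF A(1)] by auto
    moreover have "pure [(\<Sum>a\<in>F. scale (c a) a), w] = (\<Sum>a\<in>F. pure [a, scale (c a) w])"
      if "finite F" for F
      using that
    proof induction
      case empty
      show ?case using pure_linear(3)[of "[]" "[w]"] by simp
    next
      case (insert a F)
      have "pure [scale (c a) a, w] = pure [a, scale (c a) w]"
        using pure_linear(2)[of "[]" "c a" a "[w]"] pure_linear(2)[of "[a]" "c a" w "[]"] by simp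
      then show ?case
        using insert pure_linear(1)[of "[]" "scale (c a) a" "\<Sum>a\<in>F. scale (c a) a" "[w]"] by simp
    qed
    ultimately show ?thesis
      using A(1) by (intro exI[of _ "\<lambda>a. scale (c a) w"]) simp
  qed
  show ?thesis
    using t unfolding tensor_power_def
  proof (induction rule: tensor.span_induct_alt)
    case base
    have "pure [a, 0] = 0" for a
      using pure_linear(3)[of "[a]" "[]"] by simp
    then have "0 = (\<Sum>a\<in>A. pure [a, 0])" by simp
    then show ?case by (rule exI[of _ "\<lambda>_. 0"])
  next
    case (step c p t)
    then obtain v w where "p = pure [v, w]"
      by (auto simp: numeral_2_eq_2 length_Suc_conv)
    then obtain z where z: "p = (\<Sum>a\<in>A. pure [a, z a])"
      using pure2[of v w] by auto
    obtain z' where z': "t = (\<Sum>a\<in>A. pure [a, z' a])"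
      using step(2) by auto
    have "pure [a, scale c (z a) + z' a] = tensor_scale c (pure [a, z a]) + pure [a, z' a]" for a
      using pure_linear(1)[of "[a]" "scale c (z a)" "z' a" "[]"]
        pure_linear(2)[of "[a]" c "z a" "[]"] by simp
    then have "tensor_scale c p + t = (\<Sum>a\<in>A. pure [a, scale c (z a) + z' a])"
      by (simp add: z z' tensor.scale_sum_right sum.distrib)
    then show ?case by (rule exI[of _ "\<lambda>a. scale c (z a) + z' a"])
  qed
qed

text \<open>
  One slot of the construction: the slot receives \<open>y\<close> from the slot before it, gets the basis \<open>A\<close>
  with leading letter \<open>x\<close>, and hands \<open>y'\<close> on to the next slot. There \<open>y'\<close> has to be part of a
  basis, hence nonzero.
\<close>
definition leading_step where
  "leading_step f y A x y' \<longleftrightarrow> independent A \<and> span A = UNIV \<and> x \<in> A \<and> y \<in> A \<and> x \<noteq> y \<and> y' \<noteq> 0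
     \<and> f - pure [x, y'] \<in> tensor.span {pure [b, v] | b v. b \<in> A - {x}}"

lemma leading_step_exists:
  assumes f: "f \<in> tpow 2" and y: "y \<noteq> 0" and no: "\<And>v. f \<noteq> pure [y, v]"
  shows "\<exists>A x y'. leading_step f y A x y'"
proof -
  define A where "A = extend_basis {y}"
  have A: "independent A" "span A = UNIV" "y \<in> A"
    using y extend_basis_superset[of "{y}"] independent_extend_basis[of "{y}"]
    by (auto simp: A_def)
  have finA: "finite A"
    using card_of_basis[OF A(1,2)] by simp
  obtain z where z: "f = (\<Sum>a\<in>A. pure [a, z a])"
    using tensor_square_expansion[OF finA A(2) f] by blast
  obtain x where x: "x \<in> A" "x \<noteq> y" "z x \<noteq> 0"
  proof (rule ccontr)
    assume "\<not> thesis"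
    then have "z a = 0" if "a \<in> A - {y}" for a
      using that \<open>\<And>x. x \<in> A \<Longrightarrow> x \<noteq> y \<Longrightarrow> z x \<noteq> 0 \<Longrightarrow> thesis\<close> by blast
    moreover have "pure [a, 0] = 0" for a
      using pure_linear(3)[of "[a]" "[]"] by simp
    ultimately have "(\<Sum>a\<in>A - {y}. pure [a, z a]) = 0"
      by (intro sum.neutral) metis
    then have "f = pure [y, z y]"
      using z sum.remove[OF finA A(3), of "\<lambda>a. pure [a, z a]"] by simp
    with no show False by blast
  qed
  have "f - pure [x, z x] = (\<Sum>a\<in>A - {x}. pure [a, z a])"
    using z sum.remove[OF finA x(1), of "\<lambda>a. pure [a, z a]"] by simp
  also have "\<dots> \<in> tensor.span {pure [b, v] | b v. b \<in> A - {x}}"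
    by (rule tensor.span_sum) (auto intro: tensor.span_base)
  finally show ?thesis
    using A x unfolding leading_step_def by blast
qed

text \<open>
  The predicate \<open>Q\<close> is an invariant of the vectors handed from slot to slot, strong enough for the
  next step to exist.
\<close>
lemma distributive_if_leading_steps:
  assumes f: "f \<in> tpow 2" and "Q y\<^sub>0"
    and step: "\<And>y. Q y \<Longrightarrow> \<exists>A x y'. Q y' \<and> leading_step f y A x y'"
  shows "distributive_homogeneous_algebra scale 2 (tensor.span {f})"
proof -
  obtain A x y' where next_step: "\<And>y. Q y \<Longrightarrow> Q (y' y) \<and> leading_step f y (A y) (x y) (y' y)"
    using step by metis
  define ys where "ys j = (y' ^^ j) y\<^sub>0" for j
  have "Q (ys j)" for j
    using assms(2) next_step by (induction j) (auto simp: ys_def)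
  then have "leading_step f (ys j) (A (ys j)) (x (ys j)) (ys (Suc j))" for j
    using next_step[of "ys j"] by (simp add: ys_def)
  then interpret slotwise_leading_term scale Basis f "\<lambda>j. A (ys j)" "\<lambda>j. x (ys j)" ys
    by unfold_locales (auto simp: leading_step_def f)
  show ?thesis by (rule distributive)
qed

lemma distributive_decomposable:
  assumes "u \<noteq> 0" "v \<noteq> 0"
  shows "distributive_homogeneous_algebra scale 2 (tensor.span {pure [u, v]})"
proof (cases "v \<in> span {u}")
  case True
  then obtain c where c: "v = scale c u"
    by (auto simp: span_singleton)
  then have "pure [u, v] = tensor_scale c (pure [u, u])" "c \<noteq> 0"
    using pure_linear(2)[of "[u]" c u "[]"] assms by auto
  then have "tensor.span {pure [u, v]} = tensor.span {pure [u, u]}"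
    using tensor.span_image_scale[of "{pure [u, u]}" "\<lambda>_. c"] by simp
  then show ?thesis
    using distributive_square[OF assms(1)] by simp
next
  case False
  define A where "A = extend_basis {u, v}"
  have ind: "independent {u, v}" "u \<noteq> v"
    using False assms(1) independent_insert[of v "{u}"] span_base[of v "{v}"] by (auto simp: insert_commute)
  then have "leading_step (pure [u, v]) v A u v"
    using extend_basis_superset[OF ind(1)] independent_extend_basis[OF ind(1)] assms
    by (auto simp: leading_step_def A_def tensor.span_zero)
  then show ?thesis
    by (intro distributive_if_leading_steps[where Q = "\<lambda>y. y = v"] pure_tensor_in_power) auto
qed

end

theorem theorem5p6:
  fixes scale :: "'k::field \<Rightarrow> 'v::ab_group_add \<Rightarrow> 'v"
    and Basis :: "'v set" and n :: nat
    and f :: "('k, 'v) tensor" and R :: "('k, 'v) tensor set"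
  assumes "finite_dimensional_vector_space scale Basis"
    and "vector_space.dim scale (UNIV :: 'v set) = n" and "n \<ge> 1"
    and "f \<in> tensor_power scale 2" and "f \<noteq> 0"
    and "R = tensor.span {f}"
  shows "distributive_homogeneous_algebra scale 2 R"
proof -
  interpret finite_dimensional_vector_space scale Basis by fact
  interpret finite_tensor_products scale Basis by unfold_locales
  show ?thesis
  proof (cases "\<exists>u v. f = pure [u, v]")
    case True
    then obtain u v where f: "f = pure [u, v]" by blast
    have "u \<noteq> 0" "v \<noteq> 0"
      using assms(5) f pure_linear(3)[of "[]" "[v]"] pure_linear(3)[of "[u]" "[]"] by auto
    then show ?thesis
      using distributive_decomposable f assms(6) by simp
  next
    case False
    have "Basis \<noteq> {}"
      using assms(2,3) by auto
    then obtain y\<^sub>0 where "y\<^sub>0 \<in> Basis" by blast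
    then have y0: "y\<^sub>0 \<noteq> 0"
      using independent_Basis dependent_zero by blast
    have step: "\<exists>A x y'. y' \<noteq> 0 \<and> leading_step f y A x y'" if "y \<noteq> 0" for y
      using leading_step_exists[OF assms(4) that] False by (metis leading_step_def)
    show ?thesis
      unfolding assms(6)
      by (rule distributive_if_leading_steps[where Q = "\<lambda>y. y \<noteq> 0", OF assms(4) y0 step])
  qed
qed

end
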